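(* Let $n\ge1$, $0<p\le1$, and let $A\subset C_n$ be non-empty. Let $\rho=\frac p2-\frac{\Delta(A,p)}{n}$. Then $$\frac{\rho^2}{p}\le\frac{\ln|A|}{n}.$$ Suppose moreover that $\rho\le1/4$ and $$p\ge\frac{\ln2+\ln(1-2\rho)}{\ln(1-2\rho)-\ln(2\rho)}.$$ Then $$\frac{\ln|A|}{n}\le 2\rho\ln\frac1{2\rho}+(1-2\rho)\ln\frac1{1-2\rho}.$$
   Context: $C_n=\{0,1\}^n$ with the uniform probability measure. Fix $0<p\le1$, $q=1-p$. For $x=(\xi_1,\dots,\xi_n),y=(\eta_1,\dots,\eta_n)\in C_n$ and $l=(\lambda_1,\dots,\lambda_n)\in\{0,1\}^n$ set $d_l(x,y)=\sum_{i:\xi_i\ne\eta_i}\lambda_i$ and $d_l(x,A)=\min_{y\in A}d_l(x,y)$. Define $\Delta(A,p)$ as the expected value of $d_l(x,A)$ where $x$ is uniform in $C_n$ and, independently, $l$ has independent coordinates with $\Pr(\lambda_i=1)=p$, $\Pr(\lambda_i=0)=q$; i.e. $\Delta(A,p)=\sum_{l}\sum_{x}d_l(x,A)\,p^{|l|}q^{n-|l|}2^{-n}$ with $|l|=\sum\lambda_i$. For non-empty $A$, $0\le\rho\le p/2$. Conventions when $\rho=0$: $0\ln\frac10=0$ and the right-hand side of the condition on $p$ is interpreted as its limit $0$. *)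

theory Defs
  imports "HOL-Probability.Probability"
begin

definition cube :: "nat \<Rightarrow> (nat \<Rightarrow> nat) set" where
  "cube n = {..<n} \<rightarrow>\<^sub>E {0, 1}"

definition wdist :: "nat \<Rightarrow> (nat \<Rightarrow> nat) \<Rightarrow> (nat \<Rightarrow> nat) \<Rightarrow> (nat \<Rightarrow> nat) \<Rightarrow> nat" where
  "wdist n l x y = (\<Sum>i | i < n \<and> x i \<noteq> y i. l i)"

definition wdist_set :: "nat \<Rightarrow> (nat \<Rightarrow> nat) \<Rightarrow> (nat \<Rightarrow> nat) \<Rightarrow> (nat \<Rightarrow> nat) set \<Rightarrow> nat" where
  "wdist_set n l x A = Min ((\<lambda>y. wdist n l x y) ` A)"

text \<open>The default value \<^term>\<open>undefined\<close> outside \<open>{..<n}\<close> makes the samples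
  extensional functions, that is, elements of \<open>cube n\<close>.\<close>

definition weight_pmf :: "nat \<Rightarrow> real \<Rightarrow> (nat \<Rightarrow> nat) pmf" where
  "weight_pmf n p = Pi_pmf {..<n} undefined (\<lambda>_. map_pmf of_bool (bernoulli_pmf p))"

definition Delta :: "nat \<Rightarrow> (nat \<Rightarrow> nat) set \<Rightarrow> real \<Rightarrow> real" where
  "Delta n A p = measure_pmf.expectation (pair_pmf (pmf_of_set (cube n)) (weight_pmf n p))
     (\<lambda>(x, l). real (wdist_set n l x A))"

text \<open>The lower bound on \<open>p\<close> as a function of \<open>\<rho> \<in> [0, 1/4]\<close>. The formula is meaningless at
  both endpoints (\<open>ln 0\<close>, respectively \<open>0 / 0\<close>); there the value is its limit.\<close>

definition p_bound :: "real \<Rightarrow> real" where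
  "p_bound \<rho> =
    (if \<rho> = 0 then 0
     else if \<rho> = 1/4 then 1/2
     else (ln 2 + ln (1 - 2 * \<rho>)) / (ln (1 - 2 * \<rho>) - ln (2 * \<rho>)))"

lemma finite_cube: "finite (cube n)"
  by (simp add: cube_def finite_PiE)

lemma cube_nonempty: "cube n \<noteq> {}"
  by (simp add: cube_def PiE_eq_empty_iff)

lemma card_cube: "card (cube n) = 2 ^ n"
  by (simp add: cube_def card_PiE numeral_2_eq_2)

lemma pmf_weight_factor:
  assumes "0 \<le> p" "p \<le> 1" "k \<in> {0, 1}"
  shows "pmf (map_pmf of_bool (bernoulli_pmf p)) (k::nat) = p ^ k * (1 - p) ^ (1 - k)"
proof -
  have inj: "inj (of_bool :: bool \<Rightarrow> nat)" by (auto simp: inj_def)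
  have "pmf (map_pmf of_bool (bernoulli_pmf p)) (of_bool b :: nat) = (if b then p else 1 - p)" for b
    using assms(1,2) by (subst pmf_map_inj'[OF inj]) simp
  from this[of True] this[of False] show ?thesis
    using assms(3) by auto
qed

lemma pmf_weight_pmf:
  assumes "0 \<le> p" "p \<le> 1" "l \<in> cube n"
  shows "pmf (weight_pmf n p) l = p ^ (\<Sum>i<n. l i) * (1 - p) ^ (n - (\<Sum>i<n. l i))"
proof -
  have l: "l i \<in> {0, 1}" if "i < n" for i using assms(3) that by (auto simp: cube_def)
  have "pmf (weight_pmf n p) l = (\<Prod>i<n. pmf (map_pmf of_bool (bernoulli_pmf p)) (l i))"
    unfolding weight_pmf_def
    by (rule pmf_Pi') (use assms(3) in \<open>auto simp: cube_def PiE_def extensional_def\<close>)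
  also have "\<dots> = (\<Prod>i<n. p ^ l i * (1 - p) ^ (1 - l i))"
    using l assms(1,2) by (intro prod.cong refl pmf_weight_factor) auto
  also have "\<dots> = p ^ (\<Sum>i<n. l i) * (1 - p) ^ (\<Sum>i<n. 1 - l i)"
    by (simp add: prod.distrib power_sum)
  also have "(\<Sum>i<n. 1 - l i) = (\<Sum>i<n. 1) - (\<Sum>i<n. l i)"
    using l by (intro sum_subtractf_nat) fastforce
  finally show ?thesis by simp
qed

lemma set_weight_pmf: "set_pmf (weight_pmf n p) \<subseteq> cube n"
proof -
  have "set_pmf (weight_pmf n p) \<subseteq> PiE_dflt {..<n} undefined (\<lambda>_. range of_bool)"
    unfolding weight_pmf_def by (subst set_Pi_pmf) (auto simp: PiE_dflt_def)
  also have "\<dots> \<subseteq> cube n"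
    by (fastforce simp: PiE_dflt_def cube_def PiE_def extensional_def)
  finally show ?thesis .
qed

lemma Delta_eq_sum:
  assumes "0 \<le> p" "p \<le> 1"
  shows "Delta n A p = (\<Sum>l\<in>cube n. \<Sum>x\<in>cube n. real (wdist_set n l x A) *
           p ^ (\<Sum>i<n. l i) * (1 - p) ^ (n - (\<Sum>i<n. l i)) / 2 ^ n)"
proof -
  have "Delta n A p = (\<Sum>z\<in>cube n \<times> cube n. (case z of (x, l) \<Rightarrow> real (wdist_set n l x A)) *
          pmf (pair_pmf (pmf_of_set (cube n)) (weight_pmf n p)) z)"
    unfolding Delta_def
    by (rule integral_measure_pmf_real)
       (use set_weight_pmf in \<open>auto simp: finite_cube cube_nonempty\<close>)
  also have "\<dots> = (\<Sum>x\<in>cube n. \<Sum>l\<in>cube n. real (wdist_set n l x A) *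
           p ^ (\<Sum>i<n. l i) * (1 - p) ^ (n - (\<Sum>i<n. l i)) / 2 ^ n)"
    unfolding sum.cartesian_product
    by (intro sum.cong refl)
       (auto simp: pmf_pair pmf_weight_pmf[OF assms] finite_cube cube_nonempty card_cube)
  also have "\<dots> = (\<Sum>l\<in>cube n. \<Sum>x\<in>cube n. real (wdist_set n l x A) *
           p ^ (\<Sum>i<n. l i) * (1 - p) ^ (n - (\<Sum>i<n. l i)) / 2 ^ n)"
    by (rule sum.swap)
  finally show ?thesis .
qed

end

theory Submission
  imports Defs "HOL-Real_Asymp.Real_Asymp"
begin

text \<open>
  Write \<open>R(A) = p n / 2 - \<Delta>(A, p)\<close>.  The lower bound on \<open>ln |A|\<close> is the usual estimate for the
  expected maximum of \<open>|A|\<close> random variables by their moment generating function: each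
  \<open>|l| / 2 - d\<^sub>l(x, a)\<close> has moment generating function \<open>(q + p cosh (t / 2))\<^sup>n\<close>, and
  \<open>t = 2 \<rho> / p\<close> suffices.

  For the upper bound, the entropy is replaced by its tangent line at \<open>\<tau> = 2 \<rho>\<close>, which reads
  \<open>\<alpha> + \<beta> \<rho>\<close> with \<open>\<alpha> = - ln (1 - \<tau>)\<close> and \<open>\<beta> = 2 ln ((1 - \<tau>) / \<tau>)\<close>.
  The inequality \<open>ln |A| \<le> n \<alpha> + \<beta> R(A)\<close> holds for all \<open>A\<close> by induction on \<open>n\<close>: if \<open>A\<^sub>0, A\<^sub>1\<close> are
  the slices of \<open>A\<close> with respect to the last coordinate, then \<open>R(A) \<ge> R(A\<^sub>0)\<close> and
  \<open>R(A) \<ge> p / 2 + (1 - p / 2) R(A\<^sub>0) + (p / 2) R(A\<^sub>1)\<close>.  The first bound is good enough if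
  \<open>|A\<^sub>1| / |A\<^sub>0|\<close> is at most \<open>\<tau> / (1 - \<tau>)\<close>, and the second one otherwise, by the convexity of
  \<open>ln (1 + exp s)\<close>; at \<open>|A\<^sub>1| = |A\<^sub>0|\<close> what is needed is exactly the condition on \<open>p\<close>.
\<close>

section \<open>Splitting the cube along its last coordinate\<close>

lemma cube_0: "cube 0 = {\<lambda>_. undefined}"
  by (simp add: cube_def)

lemma cube_Suc: "cube (Suc n) = (\<lambda>(b, x). x(n := b)) ` ({0, 1} \<times> cube n)"
  by (simp add: cube_def lessThan_Suc PiE_insert_eq)

lemma inj_on_fun_upd_cube: "inj_on (\<lambda>x. x(n := b)) (cube n)"
proof (rule inj_onI)
  fix x y assume "x \<in> cube n" "y \<in> cube n" "x(n := b) = y(n := b)"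
  \<comment> \<open>Index \<open>n\<close> lies outside \<open>{..<n}\<close>, where both points
    have the default value \<open>undefined\<close>; overwriting it loses no information.\<close>
  moreover from this have "x n = y n" by (simp add: cube_def PiE_def extensional_def)
  ultimately show "x = y" by (metis fun_upd_triv fun_upd_upd)
qed

lemma cube_Suc_Un: "cube (Suc n) = (\<lambda>x. x(n := 0)) ` cube n \<union> (\<lambda>x. x(n := 1)) ` cube n"
  by (auto simp: cube_Suc)

lemma sum_cube_Suc:
  fixes g :: "(nat \<Rightarrow> nat) \<Rightarrow> real"
  shows "sum g (cube (Suc n)) = (\<Sum>x\<in>cube n. g (x(n := 0)) + g (x(n := 1)))"
proof -
  have "((\<lambda>x. x(n := 0)) ` cube n) \<inter> ((\<lambda>x. x(n := 1)) ` cube n) = {}"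
    by (metis (no_types, lifting) disjoint_iff fun_upd_same imageE zero_neq_one)
  then show ?thesis
    unfolding cube_Suc_Un
    by (simp add: sum.union_disjoint finite_cube sum.reindex inj_on_fun_upd_cube sum.distrib)
qed

section \<open>Expectation over a random weight and a random point\<close>

definition cube_mean :: "nat \<Rightarrow> real \<Rightarrow> ((nat \<Rightarrow> nat) \<Rightarrow> (nat \<Rightarrow> nat) \<Rightarrow> real) \<Rightarrow> real" where
  "cube_mean n p f = (\<Sum>l\<in>cube n. \<Sum>x\<in>cube n. f l x *
     (p ^ (\<Sum>i<n. l i) * (1 - p) ^ (n - (\<Sum>i<n. l i)) / 2 ^ n))"

lemma Delta_eq_cube_mean:
  "0 \<le> p \<Longrightarrow> p \<le> 1 \<Longrightarrow> Delta n A p = cube_mean n p (\<lambda>l x. real (wdist_set n l x A))"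
  by (simp add: Delta_eq_sum cube_mean_def mult.assoc)

lemma cube_mean_0: "cube_mean 0 p f = f (\<lambda>_. undefined) (\<lambda>_. undefined)"
  by (simp add: cube_mean_def cube_0)

lemma sum_le_of_cube:
  assumes "l \<in> cube n"
  shows "(\<Sum>i<n. l i) \<le> n"
proof -
  have "l i \<le> 1" if "i < n" for i
  proof -
    have "l i \<in> {0, 1}"
      using assms that PiE_mem[of l "{..<n}" "\<lambda>_. {0, 1}" i] unfolding cube_def lessThan_iff by blast
    then show ?thesis by auto
  qed
  then show ?thesis using sum_mono[of "{..<n}" l "\<lambda>_. 1"] by simp
qed

text \<open>The mass factors over coordinates, so the last coordinates of weight and point can be
  averaged out first. The inductions on the dimension rest on this recursion.\<close>

lemma cube_mean_Suc:
  "cube_mean (Suc n) p f = cube_mean n p (\<lambda>l x.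
     (1 - p) / 2 * (f (l(n := 0)) (x(n := 0)) + f (l(n := 0)) (x(n := 1))) +
     p / 2 * (f (l(n := 1)) (x(n := 0)) + f (l(n := 1)) (x(n := 1))))"
  unfolding cube_mean_def sum_cube_Suc sum.distrib[symmetric]
proof (intro sum.cong refl)
  fix l x assume "l \<in> cube n" "x \<in> cube n"
  have "(\<Sum>i<n. (l(n := b)) i) = (\<Sum>i<n. l i)" for b
    by (intro sum.cong) auto
  \<comment> \<open>Subtraction on naturals is truncated, so this needs the weight sum to be at most
    \<open>n\<close>.\<close>
  moreover have "Suc n - (\<Sum>i<n. l i) = Suc (n - (\<Sum>i<n. l i))"
    using sum_le_of_cube[OF \<open>l \<in> cube n\<close>] by simp
  ultimately show "f (l(n := 0)) (x(n := 0)) *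
        (p ^ (\<Sum>i<Suc n. (l(n := 0)) i) * (1 - p) ^ (Suc n - (\<Sum>i<Suc n. (l(n := 0)) i)) / 2 ^ Suc n) +
      f (l(n := 0)) (x(n := 1)) *
        (p ^ (\<Sum>i<Suc n. (l(n := 0)) i) * (1 - p) ^ (Suc n - (\<Sum>i<Suc n. (l(n := 0)) i)) / 2 ^ Suc n) +
      (f (l(n := 1)) (x(n := 0)) *
        (p ^ (\<Sum>i<Suc n. (l(n := 1)) i) * (1 - p) ^ (Suc n - (\<Sum>i<Suc n. (l(n := 1)) i)) / 2 ^ Suc n) +
      f (l(n := 1)) (x(n := 1)) *
        (p ^ (\<Sum>i<Suc n. (l(n := 1)) i) * (1 - p) ^ (Suc n - (\<Sum>i<Suc n. (l(n := 1)) i)) / 2 ^ Suc n)) =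
      ((1 - p) / 2 * (f (l(n := 0)) (x(n := 0)) + f (l(n := 0)) (x(n := 1))) +
        p / 2 * (f (l(n := 1)) (x(n := 0)) + f (l(n := 1)) (x(n := 1)))) *
      (p ^ (\<Sum>i<n. l i) * (1 - p) ^ (n - (\<Sum>i<n. l i)) / 2 ^ n)"
    by (simp add: field_simps)
qed

lemma cube_mean_add: "cube_mean n p (\<lambda>l x. f l x + g l x) = cube_mean n p f + cube_mean n p g"
  by (simp add: cube_mean_def sum.distrib distrib_right add_divide_distrib)

lemma cube_mean_cmult: "cube_mean n p (\<lambda>l x. c * f l x) = c * cube_mean n p f"
  by (simp add: cube_mean_def sum_distrib_left mult.assoc)

lemma cube_mean_const: "cube_mean n p (\<lambda>_ _. c) = c"
  by (induction n arbitrary: c) (simp_all add: cube_mean_0 cube_mean_Suc field_simps)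

lemma cube_mean_sum: "cube_mean n p (\<lambda>l x. \<Sum>a\<in>A. f a l x) = (\<Sum>a\<in>A. cube_mean n p (f a))"
  by (induction A rule: infinite_finite_induct) (simp_all add: cube_mean_const cube_mean_add)

lemma cube_mean_mono:
  assumes "0 \<le> p" "p \<le> 1"
    and "\<And>l x. l \<in> cube n \<Longrightarrow> x \<in> cube n \<Longrightarrow> f l x \<le> g l x"
  shows "cube_mean n p f \<le> cube_mean n p g"
  unfolding cube_mean_def using assms by (intro sum_mono mult_right_mono) auto

text \<open>Jensen's inequality for \<open>exp\<close>: average the tangent bound
  \<open>1 + u \<le> exp u\<close> at \<open>u = f l x - m\<close>, with \<open>m\<close> the mean
  of \<open>f\<close>.\<close>

lemma exp_cube_mean_le:
  assumes "0 \<le> p" "p \<le> 1"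
  shows "exp (cube_mean n p f) \<le> cube_mean n p (\<lambda>l x. exp (f l x))"
proof -
  define m where "m = cube_mean n p f"
  have "1 = cube_mean n p (\<lambda>l x. (1 - m) + f l x)"
    by (simp add: cube_mean_add cube_mean_const m_def)
  also have "\<dots> \<le> cube_mean n p (\<lambda>l x. exp (- m) * exp (f l x))"
  proof (rule cube_mean_mono[OF assms])
    show "(1 - m) + f l x \<le> exp (- m) * exp (f l x)" for l x
      using exp_ge_add_one_self[of "f l x - m"] by (simp add: exp_diff exp_minus field_simps)
  qed
  also have "\<dots> = exp (- m) * cube_mean n p (\<lambda>l x. exp (f l x))"
    by (rule cube_mean_cmult)
  finally show ?thesis by (simp add: m_def exp_minus field_simps)
qed

section \<open>Weighted distances and the moment generating function of one point\<close>

lemma wdist_Suc: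
  "wdist (Suc n) (l(n := b)) (x(n := c)) a = wdist n l x a + (if c \<noteq> a n then b else 0)"
proof -
  have "{i. i < Suc n \<and> (x(n := c)) i \<noteq> a i} =
      {i. i < n \<and> x i \<noteq> a i} \<union> (if c \<noteq> a n then {n} else {})"
    by (auto simp: less_Suc_eq)
  moreover have "(\<Sum>i | i < n \<and> x i \<noteq> a i. (l(n := b)) i) = (\<Sum>i | i < n \<and> x i \<noteq> a i. l i)"
    by (intro sum.cong) auto
  ultimately show ?thesis
    unfolding wdist_def by (subst (1) \<open>_ = _ \<union> _\<close>, subst sum.union_disjoint) auto
qed

lemma wdist_fun_upd: "wdist n l x (y(n := b)) = wdist n l x y"
  unfolding wdist_def by (intro sum.cong) auto

lemma wdist_set_le: "finite A \<Longrightarrow> a \<in> A \<Longrightarrow> wdist_set n l x A \<le> wdist n l x a"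
  by (simp add: wdist_set_def)

lemma wdist_set_attained:
  assumes "finite A" "A \<noteq> {}"
  obtains a where "a \<in> A" "wdist_set n l x A = wdist n l x a"
  using Min_in[of "(\<lambda>y. wdist n l x y) ` A"] assms unfolding wdist_set_def by blast

text \<open>Coordinates contribute independent factors. One of weight 0 contributes 1; one of weight
  1 adds \<open>t / 2\<close> or \<open>- t / 2\<close> to the exponent, equally likely, whence
  \<open>cosh (t / 2)\<close>.\<close>

lemma cube_mean_exp_wdist:
  assumes "\<forall>i<n. a i \<in> {0, 1}"
  shows "cube_mean n p (\<lambda>l x. exp (t * (real (\<Sum>i<n. l i) / 2 - real (wdist n l x a)))) =
    (1 - p + p * cosh (t / 2)) ^ n"
  using assms
proof (induction n)
  case 0
  then show ?case by (simp add: cube_mean_0 wdist_def)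
next
  case (Suc n)
  have upd: "(\<Sum>i<n. (l(n := b)) i) = (\<Sum>i<n. l i)" for l :: "nat \<Rightarrow> nat" and b
    by (intro sum.cong) auto
define Z where "Z l x = exp (t * (real (\<Sum>i<n. l i) / 2 - real (wdist n l x a)))" for l x
  have Z: "exp (t * (real (\<Sum>i<Suc n. (l(n := b)) i) / 2 - real (wdist (Suc n) (l(n := b)) (x(n := c)) a))) =
      exp (t * (b / 2 - (if c \<noteq> a n then b else 0))) * Z l x" for l x b c
    unfolding wdist_Suc Z_def by (simp add: upd field_simps flip: exp_add)
  have "a n = 0 \<or> a n = 1" using Suc.prems by auto
  then have "cube_mean (Suc n) p
      (\<lambda>l x. exp (t * (real (\<Sum>i<Suc n. l i) / 2 - real (wdist (Suc n) l x a)))) =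
    cube_mean n p (\<lambda>l x. (1 - p + p * cosh (t / 2)) * Z l x)"
    unfolding cube_mean_Suc Z
    by (intro arg_cong[where f = "cube_mean n p"] ext) (auto simp: cosh_def field_simps)
  also have "\<dots> = (1 - p + p * cosh (t / 2)) ^ Suc n"
    using Suc by (simp add: cube_mean_cmult Z_def)
  finally show ?case .
qed

section \<open>Slices of a set and recursive bounds on the mean distance\<close>

definition slice :: "nat \<Rightarrow> (nat \<Rightarrow> nat) set \<Rightarrow> nat \<Rightarrow> (nat \<Rightarrow> nat) set" where
  "slice n A b = {y \<in> cube n. y(n := b) \<in> A}"

lemma slice_subset: "slice n A b \<subseteq> cube n"
  by (auto simp: slice_def)

lemma finite_slice: "finite (slice n A b)"
  by (rule finite_subset[OF slice_subset finite_cube])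

lemma card_eq_card_slices:
  assumes "A \<subseteq> cube (Suc n)"
  shows "card A = card (slice n A 0) + card (slice n A 1)"
proof -
  let ?U = "\<lambda>b. (\<lambda>x. x(n := b)) ` slice n A b"
  have "A = ?U 0 \<union> ?U 1"
    using assms by (auto simp: cube_Suc_Un slice_def image_iff)
  moreover have "?U 0 \<inter> ?U 1 = {}"
    by (metis (no_types, lifting) disjoint_iff fun_upd_same imageE zero_neq_one)
  moreover have "card (?U b) = card (slice n A b)" for b
    by (intro card_image inj_on_subset[OF inj_on_fun_upd_cube slice_subset])
  ultimately show ?thesis
    by (metis card_Un_disjoint finite_imageI finite_slice)
qed

text \<open>Extend a nearest point of the slice by the coordinate \<open>b\<close>: it lies in
  \<open>A\<close> and pays the extra weight \<open>e\<close> only when \<open>c\<close> differs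
  from \<open>b\<close>.\<close>

lemma wdist_set_Suc_le:
  assumes "A \<subseteq> cube (Suc n)" "slice n A b \<noteq> {}"
  shows "wdist_set (Suc n) (l(n := e)) (x(n := c)) A \<le>
    wdist_set n l x (slice n A b) + (if c \<noteq> b then e else 0)"
proof -
  obtain y where y: "y \<in> slice n A b" "wdist_set n l x (slice n A b) = wdist n l x y"
    using wdist_set_attained[OF finite_slice assms(2)] by blast
  have "wdist_set (Suc n) (l(n := e)) (x(n := c)) A \<le> wdist (Suc n) (l(n := e)) (x(n := c)) (y(n := b))"
    using y finite_subset[OF assms(1) finite_cube] by (intro wdist_set_le) (auto simp: slice_def)
  then show ?thesis by (simp only: wdist_Suc wdist_fun_upd fun_upd_same y(2))
qed

text \<open>Always aim at slice \<open>b\<close>. The last coordinate then costs 1 exactly when its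
  weight is 1 and the point disagrees with \<open>b\<close>, an event of probability
  \<open>p / 2\<close>. For the codistance \<open>R\<close> this says that \<open>R\<close> of the
  slice is at most \<open>R(A)\<close>.\<close>

lemma Delta_Suc_le_slice:
  assumes "0 \<le> p" "p \<le> 1" "A \<subseteq> cube (Suc n)" "slice n A b \<noteq> {}" "b \<in> {0, 1}"
  shows "Delta (Suc n) A p \<le> Delta n (slice n A b) p + p / 2"
proof -
  let ?d = "\<lambda>l x. real (wdist_set n l x (slice n A b))"
  note le = of_nat_mono[where 'a = real, OF wdist_set_Suc_le[OF assms(3,4)]]
  have "Delta (Suc n) A p \<le> cube_mean n p (\<lambda>l x.
     (1 - p) / 2 * (?d l x + ?d l x) + p / 2 * (?d l x + (?d l x + 1)))"
    unfolding Delta_eq_cube_mean[OF assms(1,2)] cube_mean_Suc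
  proof (rule cube_mean_mono[OF assms(1,2)], rule add_mono[OF mult_left_mono mult_left_mono])
    fix l x
    let ?D = "\<lambda>c. real (wdist_set (Suc n) (l(n := 1)) (x(n := c)) A)"
    show "?D 0 + ?D 1 \<le> ?d l x + (?d l x + 1)"
      using le[of l 1 x 0] le[of l 1 x 1] assms(5) by auto
    show "real (wdist_set (Suc n) (l(n := 0)) (x(n := 0)) A) +
        real (wdist_set (Suc n) (l(n := 0)) (x(n := 1)) A) \<le> ?d l x + ?d l x"
      using le[of l 0 x 0] le[of l 0 x 1] by simp
  qed (use assms in auto)
  also have "\<dots> = cube_mean n p (\<lambda>l x. ?d l x + p / 2)"
    by (intro arg_cong[where f = "cube_mean n p"] ext) (simp add: field_simps)
  finally show ?thesis
    by (simp add: cube_mean_add cube_mean_const Delta_eq_cube_mean assms)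
qed

text \<open>Aim at slice \<open>b\<close> unless the last weight is 1 and the point disagrees with
  \<open>b\<close>; in that event, of probability \<open>p / 2\<close>, aim at the other slice. The
  last coordinate is then never paid for.\<close>

lemma Delta_Suc_le_slices:
  assumes "0 \<le> p" "p \<le> 1" "A \<subseteq> cube (Suc n)"
    and "slice n A b \<noteq> {}" "slice n A (1 - b) \<noteq> {}" "b \<in> {0, 1}"
  shows "Delta (Suc n) A p \<le> (1 - p / 2) * Delta n (slice n A b) p + p / 2 * Delta n (slice n A (1 - b)) p"
proof -
  let ?d = "\<lambda>l x. real (wdist_set n l x (slice n A b))"
  let ?e = "\<lambda>l x. real (wdist_set n l x (slice n A (1 - b)))"
  note le = of_nat_mono[where 'a = real, OF wdist_set_Suc_le[OF assms(3,4)]]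
  note le' = of_nat_mono[where 'a = real, OF wdist_set_Suc_le[OF assms(3,5)]]
  have "Delta (Suc n) A p \<le> cube_mean n p (\<lambda>l x.
     (1 - p) / 2 * (?d l x + ?d l x) + p / 2 * (?d l x + ?e l x))"
    unfolding Delta_eq_cube_mean[OF assms(1,2)] cube_mean_Suc
  proof (rule cube_mean_mono[OF assms(1,2)], rule add_mono[OF mult_left_mono mult_left_mono])
    fix l x
    let ?D = "\<lambda>c. real (wdist_set (Suc n) (l(n := 1)) (x(n := c)) A)"
    have "?D 0 + ?D 1 = ?D b + ?D (1 - b)" using assms(6) by auto
    also have "\<dots> \<le> ?d l x + ?e l x"
      using le[of l 1 x b] le'[of l 1 x "1 - b"] by simp
    finally show "?D 0 + ?D 1 \<le> ?d l x + ?e l x" .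
    show "real (wdist_set (Suc n) (l(n := 0)) (x(n := 0)) A) +
        real (wdist_set (Suc n) (l(n := 0)) (x(n := 1)) A) \<le> ?d l x + ?d l x"
      using le[of l 0 x 0] le[of l 0 x 1] by simp
  qed (use assms in auto)
  also have "\<dots> = cube_mean n p (\<lambda>l x. (1 - p / 2) * ?d l x + p / 2 * ?e l x)"
    by (intro arg_cong[where f = "cube_mean n p"] ext) (simp add: field_simps)
  also have "\<dots> = (1 - p / 2) * cube_mean n p ?d + p / 2 * cube_mean n p ?e"
    by (simp only: cube_mean_add cube_mean_cmult)
  finally show ?thesis
    by (simp add: Delta_eq_cube_mean assms)
qed

lemma Delta_0:
  assumes "A \<subseteq> cube 0" "A \<noteq> {}" "0 \<le> p" "p \<le> 1"
  shows "Delta 0 A p = 0"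
proof -
  have "A = {\<lambda>_. undefined}" using assms(1,2) by (auto simp: cube_0)
  then show ?thesis using assms(3,4)
    by (simp add: Delta_eq_cube_mean cube_mean_0 wdist_set_def wdist_def)
qed

text \<open>Descend through any non-empty slice; each coordinate costs at most \<open>p / 2\<close>.
  This is what makes \<rho> non-negative.\<close>

lemma Delta_le:
  assumes "0 \<le> p" "p \<le> 1" "A \<subseteq> cube n" "A \<noteq> {}"
  shows "Delta n A p \<le> p * n / 2"
  using assms(3,4)
proof (induction n arbitrary: A)
  case 0
  then show ?case using assms by (simp add: Delta_0)
next
  case (Suc n)
  have "slice n A 0 \<noteq> {} \<or> slice n A 1 \<noteq> {}"
    using card_eq_card_slices[OF Suc.prems(1)] Suc.prems finite_subset[OF Suc.prems(1) finite_cube]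
    by (auto simp: card_eq_0_iff)
  then obtain b :: nat where b: "b \<in> {0, 1}" "slice n A b \<noteq> {}"
    by blast
  show ?case
    using Delta_Suc_le_slice[OF assms(1,2) Suc.prems(1) b(2,1)] Suc.IH[OF slice_subset b(2)]
    by (simp add: field_simps)
qed

lemma Delta_nonneg: "0 \<le> p \<Longrightarrow> p \<le> 1 \<Longrightarrow> 0 \<le> Delta n A p"
  using cube_mean_mono[of p n "\<lambda>_ _. 0"] by (simp add: Delta_eq_cube_mean cube_mean_const)

section \<open>Lower bound on \<open>ln |A|\<close> by exponential moments\<close>

lemma cosh_le_one_plus_square:
  fixes u :: real
  assumes "0 \<le> u" "u \<le> 1"
  shows "cosh u \<le> 1 + u\<^sup>2"
proof -
  have "exp u \<le> 1 + u + u\<^sup>2" using assms by (intro exp_bound) auto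
  moreover have "exp (- u) \<le> 1 - u + u\<^sup>2"
  proof -
    \<comment> \<open>The product equals \<open>1 + u ^ 3\<close>.\<close>
    have "1 \<le> (1 + u) * (1 - u + u\<^sup>2)"
      using assms by (simp add: algebra_simps power2_eq_square)
    also have "\<dots> \<le> exp u * (1 - u + u\<^sup>2)"
      using assms by (intro mult_right_mono exp_ge_add_one_self) (auto simp: add_nonneg_nonneg)
    finally show ?thesis by (simp add: exp_minus field_simps)
  qed
  ultimately show ?thesis by (simp add: cosh_def)
qed

lemma cube_mean_weight: "cube_mean n p (\<lambda>l x. real (\<Sum>i<n. l i)) = p * n"
proof (induction n)
  case 0
  then show ?case by (simp add: cube_mean_0)
next
  case (Suc n)
  have upd: "(\<Sum>i<n. (l(n := b)) i) = (\<Sum>i<n. l i)" for l :: "nat \<Rightarrow> nat" and b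
    by (intro sum.cong) auto
  have "cube_mean (Suc n) p (\<lambda>l x. real (\<Sum>i<Suc n. l i)) =
      cube_mean n p (\<lambda>l x. real (\<Sum>i<n. l i) + p)"
    unfolding cube_mean_Suc
    by (auto simp: upd field_simps intro!: arg_cong[where f = "cube_mean n p"] ext)
  then show ?case using Suc by (simp add: cube_mean_add cube_mean_const algebra_simps)
qed

text \<open>Jensen moves \<open>exp\<close> inside the mean. The distance to \<open>A\<close> is
  attained at some \<open>a\<close>, so the exponential is one term of a sum over \<open>A\<close>
  of positive terms, and each term has the same known mean.\<close>

lemma exp_codistance_le:
  assumes "0 \<le> p" "p \<le> 1" "A \<subseteq> cube n" "A \<noteq> {}"
  shows "exp (t * (p * n / 2 - Delta n A p)) \<le> card A * (1 - p + p * cosh (t / 2)) ^ n"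
proof -
  note finA = finite_subset[OF assms(3) finite_cube]
  let ?X = "\<lambda>l x a. t * (real (\<Sum>i<n. l i) / 2 - real (wdist n l x a))"
  let ?M = "\<lambda>l x. t * (real (\<Sum>i<n. l i) / 2 - real (wdist_set n l x A))"
  have "cube_mean n p ?M = cube_mean n p (\<lambda>l x. t / 2 * real (\<Sum>i<n. l i) +
      (- t) * real (wdist_set n l x A))"
    by (simp add: algebra_simps)
  also have "\<dots> = t / 2 * (p * n) - t * Delta n A p"
    unfolding cube_mean_add cube_mean_cmult cube_mean_weight
    by (simp add: Delta_eq_cube_mean assms)
  finally have "exp (t * (p * n / 2 - Delta n A p)) = exp (cube_mean n p ?M)"
    by (simp add: algebra_simps)
  also have "\<dots> \<le> cube_mean n p (\<lambda>l x. exp (?M l x))"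
    by (rule exp_cube_mean_le) (use assms in auto)
  also have "\<dots> \<le> cube_mean n p (\<lambda>l x. \<Sum>a\<in>A. exp (?X l x a))"
  proof (rule cube_mean_mono[OF assms(1,2)])
    fix l x
    obtain a where "a \<in> A" "wdist_set n l x A = wdist n l x a"
      using wdist_set_attained[OF finA assms(4)] by blast
    then show "exp (?M l x) \<le> (\<Sum>a\<in>A. exp (?X l x a))"
      using member_le_sum[of a A "\<lambda>a. exp (?X l x a)"] finA by simp
  qed
  also have "\<dots> = (\<Sum>a\<in>A. (1 - p + p * cosh (t / 2)) ^ n)"
    unfolding cube_mean_sum
  proof (intro sum.cong refl cube_mean_exp_wdist)
    show "\<forall>i<n. a i \<in> {0, 1}" if "a \<in> A" for a
      using that assms(3) by (auto simp: cube_def)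
  qed
  finally show ?thesis by simp
qed

lemma ln_card_ge:
  assumes "0 < p" "p \<le> 1" "A \<subseteq> cube n" "A \<noteq> {}" "0 \<le> \<rho>" "\<rho> \<le> p / 2"
    and "p * n / 2 - Delta n A p = \<rho> * n"
  shows "\<rho>\<^sup>2 / p * n \<le> ln (card A)"
proof -
  \<comment> \<open>This \<open>t\<close> maximises \<open>t * \<rho> - p * (t / 2)^2\<close>, with
    maximum \<open>\<rho>^2 / p\<close>. From \<open>\<rho> \<le> p / 2\<close> it follows that
    \<open>t / 2\<close> lies in the range of the \<open>cosh\<close> bound.\<close>
  define t where "t = 2 * \<rho> / p"
  have card: "0 < card A"
    using assms(3,4) finite_subset[OF assms(3) finite_cube] by (simp add: card_gt_0_iff)
  have t: "0 \<le> t / 2" "t / 2 \<le> 1" using assms by (simp_all add: t_def field_simps)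
  have "1 - p + p * cosh (t / 2) \<le> 1 + p * (t / 2)\<^sup>2"
    using mult_left_mono[OF cosh_le_one_plus_square[OF t], of p] assms(1) by (simp add: algebra_simps)
  also have "\<dots> \<le> exp (p * (t / 2)\<^sup>2)" by (rule exp_ge_add_one_self)
  finally have "(1 - p + p * cosh (t / 2)) ^ n \<le> exp (p * (t / 2)\<^sup>2) ^ n"
    using assms(1,2) by (intro power_mono) (auto intro!: add_nonneg_nonneg mult_nonneg_nonneg simp: less_imp_le)
  then have "exp (t * (\<rho> * n)) \<le> card A * exp (n * (p * (t / 2)\<^sup>2))"
    using exp_codistance_le[of p A n t] assms
    by (smt (verit, best) exp_of_nat_mult mult_left_mono of_nat_0_le_iff)
  then have "t * (\<rho> * n) \<le> ln (card A * exp (n * (p * (t / 2)\<^sup>2)))"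
    using card by (simp add: ln_ge_iff)
  also have "\<dots> = ln (card A) + n * (p * (t / 2)\<^sup>2)"
    using card by (simp add: ln_mult)
  finally show ?thesis
    using assms(1) by (simp add: t_def power2_eq_square field_simps)
qed

section \<open>Upper bound on \<open>ln |A|\<close> by tangent lines to the entropy\<close>

lemma ln_one_plus_le:
  fixes \<tau> p a :: real
  assumes "0 < \<tau>" "\<tau> \<le> 1 / 2" "0 \<le> p" "0 < a" "a \<le> 1"
    and "ln 2 \<le> - ln (1 - \<tau>) + p * ln ((1 - \<tau>) / \<tau>)"
  shows "ln (1 + a) \<le> - ln (1 - \<tau>) \<or>
    ln (1 + a) \<le> - ln (1 - \<tau>) + p * ln ((1 - \<tau>) / \<tau>) + p / 2 * ln a"
\<comment> \<open>At this threshold \<open>1 + a\<close> equals \<open>1 / (1 - \<tau>)\<close>, so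
  the first alternative becomes an equality.\<close>
proof (cases "a \<le> \<tau> / (1 - \<tau>)")
  case True
  then have "1 + a \<le> inverse (1 - \<tau>)" using assms by (simp add: field_simps)
  then have "ln (1 + a) \<le> ln (inverse (1 - \<tau>))" using assms by (subst ln_le_cancel_iff) auto
  then show ?thesis using assms by (simp add: ln_inverse)
next
  case False
  define b where "b = ln ((1 - \<tau>) / \<tau>)"
  define f where "f = (\<lambda>s::real. ln (1 + exp s))"
  \<comment> \<open>In the variable \<open>s = ln a\<close> the second alternative compares the
    convex \<open>f\<close> with an affine function on the segment from \<open>- b\<close> to
    \<open>0\<close>, so the endpoints suffice; \<theta> is the position of \<open>ln a\<close> on
    it.\<close>
  define \<theta> where "\<theta> = - ln a / b"
  have "convex_on UNIV f"
  proof (rule convex_on_realI)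
    show "(f has_real_derivative exp s / (1 + exp s)) (at s)" for s
      unfolding f_def by (auto intro!: derivative_eq_intros simp: add_pos_pos)
    show "exp x / (1 + exp x) \<le> exp y / (1 + exp y)" if "x \<le> y" for x y :: real
      using that by (simp add: frac_le_eq add_pos_pos divide_simps algebra_simps add_nonneg_eq_0_iff)
  qed auto
  have "ln (\<tau> / (1 - \<tau>)) < ln a"
    using False assms by (subst ln_less_cancel_iff) auto
  then have lna: "- b < ln a" using assms by (simp add: b_def ln_div)
  moreover have "ln a \<le> 0" using assms by simp
  \<comment> \<open>For \<open>\<tau> = 1 / 2\<close> the threshold is 1 and the other case covers
    every \<open>a\<close>, so the division by \<open>b\<close> is safe here.\<close>
  ultimately have b: "0 < b" by linarith
  have \<theta>: "0 \<le> \<theta>" "\<theta> \<le> 1" "ln a = \<theta> * (- b)"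
    using lna b \<open>ln a \<le> 0\<close> by (auto simp: \<theta>_def field_simps)
  have "exp (- b) = \<tau> / (1 - \<tau>)" using assms by (simp add: b_def exp_minus)
  moreover have "1 + \<tau> / (1 - \<tau>) = inverse (1 - \<tau>)" using assms by (simp add: field_simps)
  ultimately have f_b: "f (- b) = - ln (1 - \<tau>)" using assms by (simp add: f_def ln_inverse)
  have "ln (1 + a) = f ((1 - \<theta>) *\<^sub>R 0 + \<theta> *\<^sub>R (- b))"
    using \<theta>(3) assms(4) by (simp add: f_def) (metis exp_ln)
  also have "\<dots> \<le> (1 - \<theta>) * f 0 + \<theta> * f (- b)"
    using \<open>convex_on UNIV f\<close> \<theta> by (intro convex_onD) auto
  also have "\<dots> \<le> (1 - \<theta>) * (- ln (1 - \<tau>) + p * b) + \<theta> * (- ln (1 - \<tau>) + p * b / 2)"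
  proof (rule add_mono[OF mult_left_mono mult_left_mono])
    show "f 0 \<le> - ln (1 - \<tau>) + p * b" using assms(6) by (simp add: f_def b_def)
    show "f (- b) \<le> - ln (1 - \<tau>) + p * b / 2" using assms(3) b by (simp add: f_b)
  qed (use \<theta> in auto)
  also have "\<dots> = - ln (1 - \<tau>) + p * b + p / 2 * ln a"
    by (simp add: \<theta>(3) algebra_simps)
  finally show ?thesis by (simp add: b_def)
qed

text \<open>The parameter \<tau> is not tied to \<open>A\<close>: it stays fixed while the induction
  passes to slices whose own codistances differ. The bound is affine in the codistance, so it is
  compatible with the weighted average of the two slices.\<close>

lemma ln_card_le:
  assumes "0 < \<tau>" "\<tau> \<le> 1 / 2" "0 \<le> p" "p \<le> 1"
    and "ln 2 \<le> - ln (1 - \<tau>) + p * ln ((1 - \<tau>) / \<tau>)"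
    and "A \<subseteq> cube n" "A \<noteq> {}"
  shows "ln (card A) \<le> n * - ln (1 - \<tau>) + 2 * ln ((1 - \<tau>) / \<tau>) * (p * n / 2 - Delta n A p)"
  using assms(6,7)
proof (induction n arbitrary: A)
  case 0
  then have "card A = 1" by (auto simp: cube_0 subset_singleton_iff)
  then show ?case using 0 assms by (simp add: Delta_0)
next
  case (Suc n)
  define \<alpha> where "\<alpha> = - ln (1 - \<tau>)"
  define \<beta> where "\<beta> = 2 * ln ((1 - \<tau>) / \<tau>)"
  define r where "r B = n * \<alpha> + \<beta> * (p * n / 2 - Delta n B p)" for B
  have "0 \<le> \<alpha>" "0 \<le> \<beta>" using assms by (simp_all add: \<alpha>_def \<beta>_def)
  let ?S = "\<lambda>b. slice n A b"
  have IH: "ln (card (?S b)) \<le> r (?S b)" if "?S b \<noteq> {}" for b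
    using Suc.IH[OF slice_subset that] by (simp add: r_def \<alpha>_def \<beta>_def)
  \<comment> \<open>Slice \<open>b\<close> is the larger one, so the ratio \<open>a\<close> below is
    at most 1.\<close>
  obtain b :: nat where b: "b \<in> {0, 1}" "card (?S (1 - b)) \<le> card (?S b)"
    by (cases "card (?S 1) \<le> card (?S 0)") (auto intro: that[of 0] that[of 1])
  have card: "card A = card (?S b) + card (?S (1 - b))"
    using card_eq_card_slices[OF Suc.prems(1)] b(1) by auto
  have "0 < card A"
    using Suc.prems finite_subset[OF Suc.prems(1) finite_cube] by (simp add: card_gt_0_iff)
  then have pos: "0 < card (?S b)" using card b(2) by linarith
  then have ne: "?S b \<noteq> {}" by auto
  have bound1: "\<alpha> + r (?S b) \<le> (n + 1) * \<alpha> + \<beta> * (p * (n + 1) / 2 - Delta (Suc n) A p)"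
    using mult_left_mono[OF Delta_Suc_le_slice[OF assms(3,4) Suc.prems(1) ne b(1)] \<open>0 \<le> \<beta>\<close>]
    by (simp add: r_def algebra_simps add_divide_distrib)
  have "ln (card A) \<le> (n + 1) * \<alpha> + \<beta> * (p * (n + 1) / 2 - Delta (Suc n) A p)"
  proof (cases "?S (1 - b) = {}")
    case True
    then show ?thesis using card IH[OF ne] bound1 \<open>0 \<le> \<alpha>\<close> by simp
  next
    case False
    then have pos': "0 < card (?S (1 - b))" by (simp add: card_gt_0_iff finite_slice)
    define a where "a = real (card (?S (1 - b))) / card (?S b)"
    have a: "0 < a" "a \<le> 1" using pos pos' b(2) by (simp_all add: a_def)
    have "real (card A) = card (?S b) * (1 + a)" using pos by (simp add: card a_def field_simps)
    then have lnA: "ln (card A) = ln (card (?S b)) + ln (1 + a)"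
      using pos a by (simp add: ln_mult)
    have ln_a: "ln a = ln (card (?S (1 - b))) - ln (card (?S b))"
      using pos pos' by (simp add: a_def ln_div)
    have bound2: "\<alpha> + \<beta> * p / 2 + (1 - p / 2) * r (?S b) + p / 2 * r (?S (1 - b)) \<le>
        (n + 1) * \<alpha> + \<beta> * (p * (n + 1) / 2 - Delta (Suc n) A p)"
      using mult_left_mono[OF Delta_Suc_le_slices[OF assms(3,4) Suc.prems(1) ne False b(1)] \<open>0 \<le> \<beta>\<close>]
      by (simp add: r_def algebra_simps add_divide_distrib diff_divide_distrib)
    have mono: "(1 - p / 2) * ln (card (?S b)) + p / 2 * ln (card (?S (1 - b))) \<le>
        (1 - p / 2) * r (?S b) + p / 2 * r (?S (1 - b))"
      using IH[OF ne] IH[OF False] assms by (intro add_mono mult_left_mono) auto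
    from ln_one_plus_le[OF assms(1,2,3) a assms(5)]
    consider "ln (1 + a) \<le> \<alpha>" | "ln (1 + a) \<le> \<alpha> + \<beta> * p / 2 + p / 2 * ln a"
      by (auto simp: \<alpha>_def \<beta>_def algebra_simps)
    then show ?thesis
    proof cases
      case 1
      then show ?thesis using lnA IH[OF ne] bound1 by linarith
    next
      case 2
      \<comment> \<open>Since \<open>ln a\<close> is the difference of the log-cardinalities, the
        term \<open>p / 2 * ln a\<close> turns \<open>ln (card (?S b))\<close> into their weighted
        average, matching \<open>bound2\<close>.\<close>
      then have "ln (card A) \<le> \<alpha> + \<beta> * p / 2 +
          ((1 - p / 2) * ln (card (?S b)) + p / 2 * ln (card (?S (1 - b))))"
        by (simp add: lnA ln_a algebra_simps)
      then show ?thesis using mono bound2 by linarith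
    qed
  qed
  then show ?case by (simp add: \<alpha>_def \<beta>_def algebra_simps)
qed

text \<open>The entropy has infinite slope at 0, so there is no tangent line to use. Instead the
  zero codistance removes the slope term for every \<tau>, the condition on \<open>p\<close> holds
  for all small \<tau> because \<open>ln ((1 - \<tau>) / \<tau>)\<close> tends to infinity, and
  letting \<tau> tend to 0 leaves \<open>ln (card A) \<le> 0\<close>.\<close>

lemma card_eq_1_of_codistance_0:
  assumes "0 < p" "p \<le> 1" "A \<subseteq> cube n" "A \<noteq> {}" "p * n / 2 = Delta n A p"
  shows "card A = 1"
proof -
  have "eventually (\<lambda>\<tau>. ln 2 \<le> - ln (1 - \<tau>) + p * ln ((1 - \<tau>) / \<tau>)) (at_right (0::real))"
    using assms(1) by real_asymp
  moreover have "eventually (\<lambda>\<tau>. 0 < \<tau> \<and> \<tau> \<le> 1 / 2) (at_right (0::real))"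
    by (auto simp: eventually_at_right_field intro!: exI[of _ "1 / 2"])
  ultimately have ev: "eventually (\<lambda>\<tau>. ln (card A) \<le> n * - ln (1 - \<tau>)) (at_right (0::real))"
  proof eventually_elim
    case (elim \<tau>)
    then show ?case using ln_card_le[of \<tau> p A n] assms by simp
  qed
  have "((\<lambda>\<tau>. n * - ln (1 - \<tau>)) \<longlongrightarrow> 0) (at_right (0::real))"
    by real_asymp
  from tendsto_lowerbound[OF this ev] have "ln (card A) \<le> 0" by simp
  moreover have "0 < card A"
    using assms(3,4) finite_subset[OF assms(3) finite_cube] by (simp add: card_gt_0_iff)
  ultimately show ?thesis by (simp add: Suc_leI le_antisym)
qed

theorem theorem4p5:
  fixes n :: nat and p \<rho> :: real and A :: "(nat \<Rightarrow> nat) set"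
  assumes "n \<ge> 1" and "0 < p" and "p \<le> 1"
    and "A \<subseteq> cube n" and "A \<noteq> {}"
    and "\<rho> = p / 2 - Delta n A p / real n"
  shows "\<rho>\<^sup>2 / p \<le> ln (real (card A)) / real n \<and>
    (\<rho> \<le> 1 / 4 \<and> p \<ge> p_bound \<rho> \<longrightarrow>
      ln (real (card A)) / real n
        \<le> 2 * \<rho> * ln (1 / (2 * \<rho>)) + (1 - 2 * \<rho>) * ln (1 / (1 - 2 * \<rho>)))"
proof (intro conjI impI)
  have R: "p * n / 2 - Delta n A p = \<rho> * n" using assms(1,6) by (simp add: field_simps)
  have "0 \<le> \<rho> * n" using Delta_le[of p A n] assms(2-5) by (simp add: mult.commute flip: R)
  then have "0 \<le> \<rho>" using assms(1) by (simp add: zero_le_mult_iff)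
  moreover have "\<rho> \<le> p / 2" using Delta_nonneg[of p n A] assms by simp
  ultimately show "\<rho>\<^sup>2 / p \<le> ln (real (card A)) / real n"
    using ln_card_ge[of p A n \<rho>] assms(1-5) R by (simp add: pos_le_divide_eq)
  assume \<rho>: "\<rho> \<le> 1 / 4 \<and> p \<ge> p_bound \<rho>"
  show "ln (real (card A)) / real n
      \<le> 2 * \<rho> * ln (1 / (2 * \<rho>)) + (1 - 2 * \<rho>) * ln (1 / (1 - 2 * \<rho>))"
  proof (cases "\<rho> = 0")
    case True
    then have "card A = 1"
      using card_eq_1_of_codistance_0[OF assms(2-5)] R by simp
    with True show ?thesis by simp
  next
    case False
    \<comment> \<open>The line tangent at this point, evaluated at the actual \<rho>, gives the
      entropy itself.\<close>
    define \<tau> where "\<tau> = 2 * \<rho>"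
    have \<tau>: "0 < \<tau>" "\<tau> \<le> 1 / 2" using False \<open>0 \<le> \<rho>\<close> \<rho> by (simp_all add: \<tau>_def)
    have "ln 2 \<le> - ln (1 - \<tau>) + p * ln ((1 - \<tau>) / \<tau>)"
    proof (cases "\<rho> = 1 / 4")
      case True
      then have "\<tau> = 1 / 2" by (simp add: \<tau>_def)
      \<comment> \<open>The logarithm of the ratio vanishes here and the claim reads
        \<open>ln 2 \<le> ln 2\<close>, whatever \<open>p\<close> is.\<close>
      then show ?thesis by (simp only:) (simp add: ln_div)
    next
      case False
      then have "\<tau> < 1 - \<tau>" using \<rho> by (simp add: \<tau>_def)
      \<comment> \<open>The denominator in \<open>p_bound\<close> is positive, so clearing it turns
        the condition on \<open>p\<close> into the required inequality.\<close>
      then have "ln \<tau> < ln (1 - \<tau>)" using \<tau> by simp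
      moreover have "(ln 2 + ln (1 - \<tau>)) / (ln (1 - \<tau>) - ln \<tau>) \<le> p"
        using \<rho> False \<open>\<rho> \<noteq> 0\<close> by (simp add: p_bound_def \<tau>_def)
      ultimately show ?thesis
        using \<tau> by (simp add: ln_div pos_divide_le_eq)
    qed
    from ln_card_le[OF \<tau> less_imp_le[OF assms(2)] assms(3) this assms(4,5)]
    have "ln (card A) \<le> n * - ln (1 - \<tau>) + 2 * ln ((1 - \<tau>) / \<tau>) * (\<rho> * n)"
      unfolding R .
    also have "\<dots> = n * (- ln (1 - \<tau>) + ln ((1 - \<tau>) / \<tau>) * \<tau>)"
      by (simp add: \<tau>_def algebra_simps)
    finally have "ln (card A) \<le> n * (- ln (1 - \<tau>) + ln ((1 - \<tau>) / \<tau>) * \<tau>)" .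
    then have "ln (card A) / n \<le> - ln (1 - \<tau>) + ln ((1 - \<tau>) / \<tau>) * \<tau>"
      using assms(1) by (simp add: pos_divide_le_eq mult.commute)
    also have "\<dots> = \<tau> * ln (1 / \<tau>) + (1 - \<tau>) * ln (1 / (1 - \<tau>))"
      using \<tau> by (simp add: ln_div algebra_simps)
    finally show ?thesis by (simp add: \<tau>_def)
  qed
qed

end
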